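(* In Twyst-off extended to allow stacks of size $\infty$, the position $(\infty,\infty,\infty)$ is a $P$ position, and the positions $(\infty,\infty,\infty,\infty)$ and $(\infty,\infty,\infty,\infty,\infty)$ are $N$ positions.
   Context: Twyst-off with infinite stacks is a two-player impartial game (players alternate; normal play: the last player to move legally wins). A position is a finite ordered sequence of stacks, each stack size being a nonnegative integer or the symbol $\infty$. Positions are subject to the identifications: an end stack of size $0$ is deleted; an interior stack of size $0$ is deleted and its two neighbors $x,y$ are combined into one stack of size $x+y$, where the sum is $\infty$ if $x$ or $y$ is $\infty$. From a position with all stacks nonzero, a move is one of: (i) remove $k\ge1$ tiles from a finite first or last stack; (ii) reduce a first or last stack of size $\infty$ to any finite size (including $0$); (iii) remove the same number $k\ge 1$ of tiles from two consecutive finite stacks; (iv) reduce two consecutive stacks $(\infty,\infty)$ to $(a,a)$ for some finite $a\ge0$; (v) reduce two consecutive stacks $(\infty,b)$ or $(b,\infty)$, with $b$ finite, to $(\infty,b')$ or $(b',\infty)$ respectively, for some $0\le b'<b$. After a move the identifications are applied. Every play is finite. A position is $P$ if the second player can force a win (no option is $P$), and $N$ if the first player can force a win (some option is $P$). *)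

theory Defs
  imports Main "HOL-Library.Extended_Nat"
begin

type_synonym position = "enat list"

definition reduced :: "position \<Rightarrow> bool" where
  "reduced p \<longleftrightarrow> 0 \<notin> set p"

(* One application of the identifications.  The rewriting is terminating and confluent (for instance
   x,0,0,y becomes x,y whichever zero is treated first), so every list has exactly one
   reduced form.  Addition on enat already satisfies x + \<infinity> = \<infinity> + x = \<infinity>. *)
inductive identify :: "position \<Rightarrow> position \<Rightarrow> bool" where
  first_zero: "identify (0 # xs) xs"
| last_zero: "identify (xs @ [0]) xs"
| interior_zero: "identify (xs @ [x, 0, y] @ ys) (xs @ [x + y] @ ys)"

(* The effect of a move before the identifications are applied. *)
inductive raw_move :: "position \<Rightarrow> position \<Rightarrow> bool" where
  first_fin: "1 \<le> k \<Longrightarrow> k \<le> m \<Longrightarrow> raw_move (enat m # xs) (enat (m - k) # xs)"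
| last_fin: "1 \<le> k \<Longrightarrow> k \<le> m \<Longrightarrow> raw_move (xs @ [enat m]) (xs @ [enat (m - k)])"
| first_inf: "raw_move (\<infinity> # xs) (enat a # xs)"
| last_inf: "raw_move (xs @ [\<infinity>]) (xs @ [enat a])"
| pair_fin: "1 \<le> k \<Longrightarrow> k \<le> m \<Longrightarrow> k \<le> n \<Longrightarrow>
    raw_move (xs @ [enat m, enat n] @ ys) (xs @ [enat (m - k), enat (n - k)] @ ys)"
| pair_inf: "raw_move (xs @ [\<infinity>, \<infinity>] @ ys) (xs @ [enat a, enat a] @ ys)"
| pair_inf_fin: "b' < b \<Longrightarrow> raw_move (xs @ [\<infinity>, enat b] @ ys) (xs @ [\<infinity>, enat b'] @ ys)"
| pair_fin_inf: "b' < b \<Longrightarrow> raw_move (xs @ [enat b, \<infinity>] @ ys) (xs @ [enat b', \<infinity>] @ ys)"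

definition move :: "position \<Rightarrow> position \<Rightarrow> bool" where
  "move p q \<longleftrightarrow> reduced p \<and> reduced q \<and> (\<exists>r. raw_move p r \<and> identify\<^sup>*\<^sup>* r q)"

(* Winning under normal play, as a least fixed point: a player forces a win in finitely many moves.
   The second player wins the empty position because it has no options. *)
inductive P_position :: "position \<Rightarrow> bool" and N_position :: "position \<Rightarrow> bool" where
  P: "reduced p \<Longrightarrow> (\<And>q. move p q \<Longrightarrow> N_position q) \<Longrightarrow> P_position p"
| N: "move p q \<Longrightarrow> P_position q \<Longrightarrow> N_position p"

end

(* Three infinite stacks: every option (a,\<infinity>,\<infinity>) has the option (a,\<infinity>,a), which is P by the mirror
   strategy, because the player who first empties an end loses. Every option (a,a,\<infinity>) has some P option
   (a,a,c): for fixed finite x and y at most one (x,y,c) is P, so if no (a,b,c) were P, each of the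
   infinitely many c would need one of finitely many P positions (x,y,c) or (a,b-k,c-k) as an option.
   From four or five infinite stacks one can move to three. *)
theory Submission
  imports Defs
begin

section \<open>Normal forms\<close>

text \<open>Carries out the identifications as one scan from the left. A zero behind a nonzero stack
  is absorbed by adding the next stack to it; if that one is also zero, this merely drops one zero
  of the run.\<close>

fun normal_form :: "position \<Rightarrow> position" where
  "normal_form [] = []"
| "normal_form [x] = (if x = 0 then [] else [x])"
| "normal_form [x, y] =
    (if x = 0 then normal_form [y] else if y = 0 then [x] else [x, y])"
| "normal_form (x # y # z # zs) =
    (if x = 0 then normal_form (y # z # zs)
     else if y = 0 then normal_form ((x + z) # zs)
     else x # normal_form (y # z # zs))"

lemma normal_form_zero_Cons: "normal_form (0 # xs) = normal_form xs"
  by (cases xs rule: normal_form.cases) auto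

lemma normal_form_Cons_Cons:
  "x \<noteq> 0 \<Longrightarrow> y \<noteq> 0 \<Longrightarrow> normal_form (x # y # ys) = x # normal_form (y # ys)"
  by (cases ys) auto

lemma normal_form_reduced: "reduced p \<Longrightarrow> normal_form p = p"
  by (induction p rule: normal_form.induct) (auto simp: reduced_def)

lemma normal_form_append_zero: "normal_form (xs @ [0]) = normal_form xs"
  by (induction xs rule: normal_form.induct) auto

text \<open>The induction follows the recursion of the scan along the prefix. Only prefixes of at
  most two stacks interact with the zero; after \<open>[u, 0]\<close> with \<open>u\<close> nonzero
  both sides merge everything, and associativity of addition makes them agree.\<close>

lemma normal_form_interior_zero:
  "normal_form (xs @ x # 0 # y # ys) = normal_form (xs @ (x + y) # ys)"
proof (induction xs rule: normal_form.induct)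
  case 1
  then show ?case by (auto simp: normal_form_zero_Cons)
next
  case (2 u)
  then show ?case
    by (cases "u = 0"; cases "x = 0")
       (auto simp: normal_form_zero_Cons normal_form_Cons_Cons)
next
  case (3 u v)
  then show ?case
    by (cases "u = 0"; cases "v = 0"; cases "x = 0")
       (auto simp: normal_form_zero_Cons normal_form_Cons_Cons add.assoc)
next
  case (4 u v w ws)
  then show ?case by auto
qed

lemma identify_normal_form: "identify p q \<Longrightarrow> normal_form p = normal_form q"
  by (induction rule: identify.induct)
     (auto simp: normal_form_zero_Cons normal_form_append_zero normal_form_interior_zero)

text \<open>\<open>normal_form\<close> is constant along \<open>identify\<close> and fixes reduced
  lists, so the raw move determines the outcome. This turns every analysis of options into a
  computation.\<close>

lemma move_normal_form:
  assumes "move p q"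
  obtains r where "raw_move p r" "q = normal_form r"
proof -
  from assms obtain r where r: "raw_move p r" "identify\<^sup>*\<^sup>* r q" "reduced q"
    by (auto simp: move_def)
  from r(2) have "normal_form r = normal_form q"
    by (induction rule: rtranclp_induct) (auto dest: identify_normal_form)
  with r that show ?thesis by (simp add: normal_form_reduced)
qed

section \<open>Outcomes\<close>

lemma P_not_N: "P_position p \<Longrightarrow> \<not> N_position p"
  and N_not_P: "N_position p \<Longrightarrow> \<not> P_position p"
proof (induction rule: P_position_N_position.inducts)
  case (P p)
  then show ?case by (auto elim: N_position.cases)
next
  case (N p q)
  then show ?case by (auto elim: P_position.cases)
qed

section \<open>Termination and determinacy for finitely many tiles\<close>

lemma identify_sum_list: "identify p q \<Longrightarrow> sum_list q = sum_list p"
  by (induction rule: identify.induct) (auto simp: add.assoc)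

text \<open>A finite total excludes infinite stacks, so only the three finite rules remain, and each
  of them removes tiles.\<close>

lemma raw_move_sum_list:
  assumes "raw_move p r" "sum_list p \<noteq> \<infinity>"
  shows "sum_list r < sum_list p"
  using assms
proof (induction rule: raw_move.induct)
  case (first_fin k m xs)
  then show ?case by (cases "sum_list xs") auto
next
  case (last_fin k m xs)
  then show ?case by (cases "sum_list xs") auto
next
  case (pair_fin k m n xs ys)
  then show ?case by (cases "sum_list xs"; cases "sum_list ys") auto
qed auto

lemma move_sum_list:
  assumes "move p q" "sum_list p \<noteq> \<infinity>"
  shows "sum_list q < sum_list p"
proof -
  from assms obtain r where r: "raw_move p r" "identify\<^sup>*\<^sup>* r q"
    by (auto simp: move_def)
  from r(2) have "sum_list q = sum_list r"
    by (induction rule: rtranclp_induct) (auto dest: identify_sum_list)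
  with raw_move_sum_list[OF r(1) assms(2)] show ?thesis by simp
qed

text \<open>\<open>P_position\<close> and \<open>N_position\<close> are least fixed points, so that
  one of them holds has to be proved; here by induction on the number of tiles.\<close>

lemma finite_position_determined:
  "reduced p \<Longrightarrow> sum_list p \<noteq> \<infinity> \<Longrightarrow> P_position p \<or> N_position p"
proof (induction "sum_list p" arbitrary: p rule: less_induct)
  case less
  have "P_position q \<or> N_position q" if "move p q" for q
  proof -
    have "sum_list q < sum_list p" by (rule move_sum_list[OF that less.prems(2)])
    moreover from this have "sum_list q \<noteq> \<infinity>" by (metis enat_ord_simps(6))
    moreover have "reduced q" using that by (simp add: move_def)
    ultimately show ?thesis using less.hyps by blast
  qed
  then show ?case using less.prems(1) by (meson P_position_N_position.intros)
qed

section \<open>Symmetry under reversing the order of the stacks\<close>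

lemma reduced_rev: "reduced (rev p) \<longleftrightarrow> reduced p"
  by (simp add: reduced_def)

lemma identify_rev: "identify p q \<Longrightarrow> identify (rev p) (rev q)"
proof (induction rule: identify.induct)
  case (interior_zero xs x y ys)
  then show ?case
    using identify.interior_zero[of "rev ys" y x "rev xs"] by (simp add: add.commute)
qed (auto intro: identify.intros)

lemma raw_move_rev: "raw_move p r \<Longrightarrow> raw_move (rev p) (rev r)"
proof (induction rule: raw_move.induct)
  case (pair_fin k m n xs ys)
  then show ?case using raw_move.pair_fin[of k n m "rev ys" "rev xs"] by simp
next
  case (pair_inf xs ys a)
  then show ?case using raw_move.pair_inf[of "rev ys" "rev xs" a] by simp
next
  case (pair_inf_fin b' b xs ys)
  then show ?case using raw_move.pair_fin_inf[of b' b "rev ys" "rev xs"] by simp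
next
  case (pair_fin_inf b' b xs ys)
  then show ?case using raw_move.pair_inf_fin[of b' b "rev ys" "rev xs"] by simp
qed (auto intro: raw_move.intros)

lemma move_rev: "move p q \<Longrightarrow> move (rev p) (rev q)"
proof -
  assume "move p q"
  then obtain r where r: "reduced p" "reduced q" "raw_move p r" "identify\<^sup>*\<^sup>* r q"
    by (auto simp: move_def)
  from r(4) have "identify\<^sup>*\<^sup>* (rev r) (rev q)"
    by (induction rule: rtranclp_induct)
       (auto intro: rtranclp.rtrancl_into_rtrancl identify_rev)
  with r show ?thesis by (auto simp: move_def reduced_rev dest: raw_move_rev)
qed

lemma P_position_rev: "P_position p \<Longrightarrow> P_position (rev p)"
  and N_position_rev: "N_position p \<Longrightarrow> N_position (rev p)"
proof (induction rule: P_position_N_position.inducts)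
  case (P p)
  have "N_position q" if "move (rev p) q" for q
    using P.IH[of "rev q"] move_rev[OF that] by simp
  with P show ?case by (auto simp: reduced_rev intro: P_position_N_position.P)
next
  case (N p q)
  then show ?case by (blast intro: P_position_N_position.N move_rev)
qed

section \<open>Finite positions with three stacks\<close>

lemma move_raw: "raw_move p q \<Longrightarrow> reduced p \<Longrightarrow> reduced q \<Longrightarrow> move p q"
  by (auto simp: move_def)

lemma move_raw_identify:
  "raw_move p r \<Longrightarrow> identify r q \<Longrightarrow> reduced p \<Longrightarrow> reduced q \<Longrightarrow> move p q"
  by (auto simp: move_def)

text \<open>Assuming the raw move lets one lemma serve both finite and infinite last stacks. If the
  last stack vanishes, \<open>xs\<close> is already reduced.\<close>

lemma move_last_to:
  assumes "raw_move (xs @ [x]) (xs @ [enat c])" "reduced (xs @ [x])"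
  shows "move (xs @ [x]) (if c = 0 then xs else xs @ [enat c])"
proof (cases "c = 0")
  case True
  have "identify (xs @ [enat c]) xs"
    using identify.last_zero[of xs] by (simp add: True zero_enat_def)
  with assms True show ?thesis
    by (auto intro!: move_raw_identify simp: reduced_def)
next
  case False
  with assms show ?thesis
    by (auto intro!: move_raw simp: reduced_def zero_enat_def)
qed

lemma raw_move_last_fin: "c' < c \<Longrightarrow> raw_move (xs @ [enat c]) (xs @ [enat c'])"
  using raw_move.last_fin[of "c - c'" c xs] by auto

text \<open>Zeros are allowed for \<open>x\<close> and \<open>y\<close> because options of
  three-stack positions may contain them; each pattern of zeros gives a different reduced
  position.\<close>

lemma move_last_stack:
  assumes "c' < c"
  shows "move (normal_form [enat x, enat y, enat c]) (normal_form [enat x, enat y, enat c'])"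
proof -
  consider "x = 0" "y = 0" | "x = 0" "y > 0" | "x > 0" "y = 0" | "x > 0" "y > 0" by auto
  then show ?thesis
  proof cases
    case 1
    then show ?thesis
      using assms move_last_to[OF raw_move_last_fin[OF assms, of "[]"]]
      by (auto simp: reduced_def zero_enat_def)
  next
    case 2
    then show ?thesis
      using assms move_last_to[OF raw_move_last_fin[OF assms, of "[enat y]"]]
      by (auto simp: reduced_def zero_enat_def split: if_splits)
  next
    case 3
    \<comment> \<open>The empty middle stack merges its neighbours, so the move takes place on a
      single stack of size \<open>x + c\<close>.\<close>
    have "x + c' < x + c" using assms by simp
    from 3 show ?thesis
      using assms move_last_to[OF raw_move_last_fin[OF \<open>x + c' < x + c\<close>, of "[]"]]
      by (auto simp: reduced_def zero_enat_def)
  next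
    case 4
    then show ?thesis
      using assms move_last_to[OF raw_move_last_fin[OF assms, of "[enat x, enat y]"]]
      by (auto simp: reduced_def zero_enat_def split: if_splits)
  qed
qed

text \<open>Otherwise the position with the larger last stack could move to the other, and no P
  position has a P option.\<close>

lemma P_last_stack_unique:
  assumes "P_position (normal_form [enat x, enat y, enat c])"
    and "P_position (normal_form [enat x, enat y, enat c'])"
  shows "c = c'"
proof -
  have False
    if "P_position (normal_form [enat x, enat y, enat d])"
      "P_position (normal_form [enat x, enat y, enat d'])" "d' < d" for d d'
    using that move_last_stack[of d' d x y] P_not_N P_position_N_position.N by blast
  with assms show ?thesis by (meson linorder_neqE_nat)
qed

text \<open>The shift by \<open>k\<close> fits the options that take \<open>k\<close> tiles from
  each of the last two stacks; \<open>k = 0\<close> fits those that leave \<open>c\<close>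
  alone.\<close>

lemma finite_P_last_stack:
  "finite {c. k \<le> c \<and> P_position (normal_form [enat x, enat y, enat (c - k)])}"
proof (rule finite_subset)
  let ?Q = "\<lambda>d. P_position (normal_form [enat x, enat y, enat d])"
  \<comment> \<open>If no suitable \<open>d\<close> exists, the set on the left is empty and the
    unspecified value of \<open>THE\<close> does no harm.\<close>
  show "{c. k \<le> c \<and> ?Q (c - k)} \<subseteq> {k + (THE d. ?Q d)}"
  proof
    fix c assume c: "c \<in> {c. k \<le> c \<and> ?Q (c - k)}"
    then have "(THE d. ?Q d) = c - k"
      by (intro the_equality) (auto simp del: normal_form.simps dest: P_last_stack_unique)
    with c show "c \<in> {k + (THE d. ?Q d)}" by simp
  qed
qed simp

lemma raw_move_three_finite:
  assumes "raw_move [enat x, enat y, enat c] r"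
  shows "(\<exists>x'\<le>x. \<exists>y'\<le>y. r = [enat x', enat y', enat c]) \<or>
    (\<exists>c'. r = [enat x, enat y, enat c']) \<or>
    (\<exists>k\<le>y. k \<le> c \<and> r = [enat x, enat (y - k), enat (c - k)])"
  using assms
  by (cases rule: raw_move.cases)
     (auto simp: Cons_eq_append_conv append_eq_Cons_conv)

lemma raw_move_two_finite:
  assumes "raw_move [enat y, enat c] r"
  shows "(\<exists>y'\<le>y. r = [enat y', enat c]) \<or>
    (\<exists>c'. r = [enat y, enat c']) \<or>
    (\<exists>k\<le>y. k \<le> c \<and> r = [enat (y - k), enat (c - k)])"
  using assms
  by (cases rule: raw_move.cases)
     (auto simp: Cons_eq_append_conv append_eq_Cons_conv)

text \<open>The alternatives sort the options by their effect on \<open>c\<close>: unchanged,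
  changed alone, or lowered together with \<open>y\<close>. The bounds on the other entries leave
  finitely many choices in the first and third. For \<open>x = 0\<close> the game is played on two
  stacks.\<close>

lemma move_three_finite:
  assumes "move (normal_form [enat x, enat y, enat c]) q" "y > 0" "c > 0"
  shows "(\<exists>x'\<le>x. \<exists>y'\<le>y. q = normal_form [enat x', enat y', enat c]) \<or>
    (\<exists>c'. q = normal_form [enat x, enat y, enat c']) \<or>
    (\<exists>k\<le>y. k \<le> c \<and> q = normal_form [enat x, enat (y - k), enat (c - k)])"
proof (cases "x = 0")
  case True
  then have nf: "normal_form [enat x, enat u, enat v] = normal_form [enat u, enat v]" for u v
    by (simp add: zero_enat_def)
  from assms True have "move [enat y, enat c] q" by (simp add: zero_enat_def)
  then obtain r where "raw_move [enat y, enat c] r" "q = normal_form r"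
    by (rule move_normal_form)
  with raw_move_two_finite[of y c r] consider
      y' where "y' \<le> y" "q = normal_form [enat x, enat y', enat c]"
    | c' where "q = normal_form [enat x, enat y, enat c']"
    | k where "k \<le> y" "k \<le> c" "q = normal_form [enat x, enat (y - k), enat (c - k)]"
    unfolding nf by blast
  then show ?thesis by cases blast+
next
  case False
  with assms have "move [enat x, enat y, enat c] q" by (simp add: zero_enat_def)
  then obtain r where "raw_move [enat x, enat y, enat c] r" "q = normal_form r"
    by (rule move_normal_form)
  with raw_move_three_finite[of x y c r] show ?thesis by blast
qed

lemma exists_P_last_stack:
  assumes "y > 0"
  shows "\<exists>c. P_position (normal_form [enat x, enat y, enat c])"
proof (rule ccontr)
  assume none: "\<nexists>c. P_position (normal_form [enat x, enat y, enat c])"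
  let ?A = "\<lambda>x y k. {c. k \<le> c \<and> P_position (normal_form [enat x, enat y, enat (c - k)])}"
  \<comment> \<open>All \<open>c\<close> for which an option of the first or third kind is P. By
    \<open>none\<close>, no option of the second kind is P.\<close>
  let ?U = "(\<Union>x'\<le>x. \<Union>y'\<le>y. ?A x' y' 0) \<union> (\<Union>k\<le>y. ?A x (y - k) k)"
  have "c \<in> ?U" if "c > 0" for c
  proof -
    let ?p = "normal_form [enat x, enat y, enat c]"
    have "reduced ?p" "sum_list ?p \<noteq> \<infinity>"
      using assms that by (auto simp: reduced_def zero_enat_def)
    with none finite_position_determined obtain q where "move ?p q" "P_position q"
      by (meson N_position.cases)
    with move_three_finite[OF this(1) assms that] none
    have "(\<exists>x'\<le>x. \<exists>y'\<le>y. c \<in> ?A x' y' 0) \<or> (\<exists>k\<le>y. c \<in> ?A x (y - k) k)"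
      by (simp only: mem_Collect_eq diff_zero le0 simp_thms) blast
    then show ?thesis by blast
  qed
  then have "{0<..} \<subseteq> ?U" by blast
  moreover have "finite ?U" by (intro finite_UnI finite_UN_I finite_P_last_stack) auto
  ultimately have "finite {0::nat<..}" by (rule finite_subset)
  then show False by (simp add: infinite_Ioi)
qed

section \<open>Positions with infinite stacks\<close>

lemma N_finite_finite_inf:
  assumes "x > 0" "y > 0"
  shows "N_position [enat x, enat y, \<infinity>]"
proof -
  from exists_P_last_stack[OF assms(2)] obtain c
    where "P_position (normal_form [enat x, enat y, enat c])" by blast
  moreover have "move [enat x, enat y, \<infinity>] (normal_form [enat x, enat y, enat c])"
    using move_last_to[of "[enat x, enat y]" \<infinity> c] raw_move.last_inf[of "[enat x, enat y]" c]
      assms by (auto simp: reduced_def zero_enat_def split: if_splits)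
  ultimately show ?thesis by (blast intro: P_position_N_position.N)
qed

lemma N_finite_inf:
  assumes "y > 0"
  shows "N_position [enat y, \<infinity>]"
proof -
  from exists_P_last_stack[OF assms] obtain c
    \<comment> \<open>The leading zero is deleted, so this is a P position on the stacks
      \<open>y\<close> and \<open>c\<close>, without the second if \<open>c = 0\<close>.\<close>
    where "P_position (normal_form [enat 0, enat y, enat c])" by blast
  moreover have "move [enat y, \<infinity>] (normal_form [enat 0, enat y, enat c])"
    using move_last_to[of "[enat y]" \<infinity> c] raw_move.last_inf[of "[enat y]" c]
      assms by (auto simp: reduced_def zero_enat_def split: if_splits)
  ultimately show ?thesis by (blast intro: P_position_N_position.N)
qed

text \<open>A pair move involving the infinite middle stack lowers only the finite end, just as an
  end move does. The two ends thus behave like two Nim heaps while both are nonempty.\<close>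

lemma raw_move_finite_inf_finite:
  assumes "raw_move [enat a, \<infinity>, enat b] r"
  shows "(\<exists>a'<a. r = [enat a', \<infinity>, enat b]) \<or> (\<exists>b'<b. r = [enat a, \<infinity>, enat b'])"
  using assms
  by (cases rule: raw_move.cases)
     (auto simp: Cons_eq_append_conv append_eq_Cons_conv)

lemma P_finite_inf_same: "a > 0 \<Longrightarrow> P_position [enat a, \<infinity>, enat a]"
proof (induction a rule: less_induct)
  case (less a)
  have N: "N_position (normal_form [enat a', \<infinity>, enat a])" if "a' < a" for a'
  proof (cases "a' = 0")
    case True
    then show ?thesis
      \<comment> \<open>Emptying the first stack leaves \<open>[\<infinity>, enat a]\<close>, from
        which the opponent wins.\<close>
      using N_position_rev[OF N_finite_inf[OF less.prems]] less.prems
      by (simp add: zero_enat_def)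
  next
    case False
    \<comment> \<open>The mirroring reply makes both ends equal again.\<close>
    have "move [enat a', \<infinity>, enat a] [enat a', \<infinity>, enat a']"
      using raw_move_last_fin[OF that, of "[enat a', \<infinity>]"] False less.prems
      by (intro move_raw) (auto simp: reduced_def zero_enat_def)
    moreover have "normal_form [enat a', \<infinity>, enat a] = [enat a', \<infinity>, enat a]"
      using False less.prems by (simp add: zero_enat_def)
    ultimately show ?thesis
      using less.IH[OF that] False by (auto intro: P_position_N_position.N)
  qed
  have N': "N_position (normal_form [enat a, \<infinity>, enat a'])" if "a' < a" for a'
  proof -
    have "normal_form [enat a, \<infinity>, enat a'] = rev (normal_form [enat a', \<infinity>, enat a])"
      using less.prems by (simp add: zero_enat_def)
    with N_position_rev[OF N[OF that]] show ?thesis by simp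
  qed
  show ?case
  proof (rule P_position_N_position.P)
    show "reduced [enat a, \<infinity>, enat a]"
      using less.prems by (simp add: reduced_def zero_enat_def)
  next
    fix q assume "move [enat a, \<infinity>, enat a] q"
    then obtain r where "raw_move [enat a, \<infinity>, enat a] r" "q = normal_form r"
      by (rule move_normal_form)
    with raw_move_finite_inf_finite N N' show "N_position q" by blast
  qed
qed

lemma P_empty: "P_position []"
  by (auto intro!: P_position_N_position.P simp: reduced_def move_def elim: raw_move.cases)

lemma N_inf: "N_position [\<infinity>]"
  using move_last_to[of "[]" \<infinity> 0] raw_move.last_inf[of "[]" 0] P_empty
  by (auto simp: reduced_def intro: P_position_N_position.N)

lemma identify_two_leading_zeros: "identify\<^sup>*\<^sup>* (enat 0 # enat 0 # xs) xs"
  using identify.first_zero[of "0 # xs"] identify.first_zero[of xs]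
  by (simp add: zero_enat_def)

text \<open>The pair rule with \<open>a = 0\<close> erases both stacks. It takes two infinite stacks
  to the empty position and five to three.\<close>

lemma move_two_leading_inf: "reduced xs \<Longrightarrow> move (\<infinity> # \<infinity> # xs) xs"
  using raw_move.pair_inf[of "[]" xs 0] identify_two_leading_zeros[of xs]
  by (auto simp: move_def reduced_def)

lemma move_leading_inf: "reduced xs \<Longrightarrow> move (\<infinity> # xs) xs"
  using raw_move.first_inf[of xs 0] identify.first_zero[of xs]
  by (auto simp: reduced_def zero_enat_def intro: move_raw_identify)

lemma N_inf_inf: "N_position [\<infinity>, \<infinity>]"
  using move_two_leading_inf[of "[]"] P_empty
  by (auto simp: reduced_def intro: P_position_N_position.N)

lemma N_finite_inf_inf:
  assumes "a > 0"
  shows "N_position [enat a, \<infinity>, \<infinity>]"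
proof -
  have "move [enat a, \<infinity>, \<infinity>] [enat a, \<infinity>, enat a]"
    using raw_move.last_inf[of "[enat a, \<infinity>]" a] assms
    by (intro move_raw) (auto simp: reduced_def zero_enat_def)
  with P_finite_inf_same[OF assms] show ?thesis by (auto intro: P_position_N_position.N)
qed

lemma raw_move_inf_inf_inf:
  assumes "raw_move [\<infinity>, \<infinity>, \<infinity>] r"
  shows "\<exists>a. r \<in> {[enat a, \<infinity>, \<infinity>], [\<infinity>, \<infinity>, enat a], [enat a, enat a, \<infinity>], [\<infinity>, enat a, enat a]}"
  using assms
  by (cases rule: raw_move.cases)
     (auto simp: Cons_eq_append_conv append_eq_Cons_conv)

lemma P_inf_inf_inf: "P_position [\<infinity>, \<infinity>, \<infinity>]"
proof (rule P_position_N_position.P)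
  show "reduced [\<infinity>, \<infinity>, \<infinity>]" by (simp add: reduced_def)
next
  fix q assume "move [\<infinity>, \<infinity>, \<infinity>] q"
  then obtain r where "raw_move [\<infinity>, \<infinity>, \<infinity>] r" and q: "q = normal_form r"
    by (rule move_normal_form)
  from raw_move_inf_inf_inf[OF this(1)] obtain a where
    r: "r \<in> {[enat a, \<infinity>, \<infinity>], [\<infinity>, \<infinity>, enat a], [enat a, enat a, \<infinity>], [\<infinity>, enat a, enat a]}"
    by blast
  show "N_position q"
  proof (cases "a = 0")
    case True
    \<comment> \<open>Emptying an end stack leaves two infinite stacks; emptying an adjacent pair
      leaves one.\<close>
    with r q show ?thesis using N_inf N_inf_inf by (auto simp: zero_enat_def)
  next
    case False
    with r q show ?thesis
      using N_finite_inf_inf[of a] N_position_rev[OF N_finite_inf_inf[of a]]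
        N_finite_finite_inf[of a a] N_position_rev[OF N_finite_finite_inf[of a a]]
      by (auto simp: zero_enat_def)
  qed
qed

theorem mainTheorem7:
  shows "P_position [\<infinity>, \<infinity>, \<infinity>] \<and>
         N_position [\<infinity>, \<infinity>, \<infinity>, \<infinity>] \<and>
         N_position [\<infinity>, \<infinity>, \<infinity>, \<infinity>, \<infinity>]"
proof -
  have "reduced [\<infinity>, \<infinity>, \<infinity>]" by (simp add: reduced_def)
  with P_inf_inf_inf show ?thesis
    by (blast intro: P_position_N_position.N move_leading_inf move_two_leading_inf)
qed

end
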